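(* Let $(\mathcal{A},\otimes,I)$ be a locally small $\dagger$-symmetric monoidal category with finite $\dagger$-biproducts and $S=\mathrm{Hom}(I,I)$. Let $(X,\mu)$ be an $H^*$-algebra in $\mathcal{A}$ with orthonormal set-like elements, and let $\mathbf{X}=R(\mu)'$ be the von Neumann $S^*$-semialgebra it generates. Then each set-like element $\alpha:I\to X$ of $(X,\mu)$ determines an $S^*$-semialgebra homomorphism $\rho_\alpha:\mathbf{X}\to S$ given by $\rho_\alpha(f)=\alpha^\dagger\circ f\circ\alpha$.
   Context: $\dagger$-symmetric monoidal category: symmetric monoidal category with identity-on-objects involutive contravariant functor $\dagger$ that is strict monoidal, with unitary structure isomorphisms. Finite $\dagger$-biproducts: zero object and biproducts with $\kappa_i^\dagger=\pi_i$; hom-sets are commutative monoids under $f+g=\nabla\circ(f\oplus g)\circ\Delta$. $S=\mathrm{Hom}(I,I)$ is a commutative $*$-semiring (addition $+$, multiplication composition, involution $\dagger$), and $\mathrm{Hom}(X,X)$ is an $S^*$-semialgebra (semiring under $+$ and composition, involution $\dagger$, scalar action $s\bullet f=X\cong X\otimes I\xrightarrow{f\otimes s}X\otimes I\cong X$). An $S^*$-semialgebra homomorphism preserves $0$, the multiplicative unit, $+$, multiplication, scalar multiplication and the involution. An $H^*$-algebra is $\mu:X\otimes X\to X$ satisfying associativity, commutativity ($\mu\circ\sigma=\mu$), speciality ($\mu\circ\mu^\dagger=\mathrm{id}_X$) and (H): for each point $x:I\to X$ there is a copoint $\tilde{x}:X\to I$ with $\mu\circ(x\otimes\mathrm{id})\circ\lambda_X^{-1}=r_X\circ(\mathrm{id}\otimes\tilde{x})\circ\mu^\dagger$.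 For a point $x$, $R_x=\mu\circ(x\otimes\mathrm{id}_X)\circ\lambda_X^{-1}$, $R(\mu)=\{R_x\}$, and $R(\mu)'=\{f:X\to X\mid f\circ g=g\circ f\ \forall g\in R(\mu)\}$ is called the semialgebra generated by $(X,\mu)$. A set-like element is a point $\alpha:I\to X$ with $\mu^\dagger\circ\alpha=(\alpha\otimes\alpha)\circ\lambda_I^{-1}$; set-like elements are required to satisfy $\alpha^\dagger=\tilde{\alpha}$. The set-like elements are orthonormal if for set-like $\alpha,\beta$, $\beta^\dagger\circ\alpha:I\to I$ is $0$ when $\alpha\neq\beta$ and $\mathrm{id}_I$ when $\alpha=\beta$. *)

theory Defs
  imports "HOL-Algebra.Module"
begin

section \<open>Categories\<close>

text \<open>The arrows of a category form a set, so all categories considered here are locally small.\<close>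

record ('o, 'm) cat =
  obj :: "'o set"
  arr :: "'m set"
  src :: "'m \<Rightarrow> 'o"
  tgt :: "'m \<Rightarrow> 'o"
  ident :: "'o \<Rightarrow> 'm"  (\<open>\<^bold>1\<index>\<close>)
  comp :: "'m \<Rightarrow> 'm \<Rightarrow> 'm"  (infixr \<open>\<cdot>\<index>\<close> 70)

definition hom :: "('o, 'm, 'z) cat_scheme \<Rightarrow> 'o \<Rightarrow> 'o \<Rightarrow> 'm set"  (\<open>Hom\<index>\<close>)
  where "Hom a b = {f \<in> arr C. src C f = a \<and> tgt C f = b}"
  for C (structure)

locale category =
  fixes C :: "('o, 'm, 'z) cat_scheme" (structure)
  assumes src_obj: "f \<in> arr C \<Longrightarrow> src C f \<in> obj C"
    and tgt_obj: "f \<in> arr C \<Longrightarrow> tgt C f \<in> obj C"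
    and ident_hom: "a \<in> obj C \<Longrightarrow> \<^bold>1 a \<in> Hom a a"
    and comp_hom: "\<lbrakk>f \<in> Hom a b; g \<in> Hom b c\<rbrakk> \<Longrightarrow> g \<cdot> f \<in> Hom a c"
    and comp_ident: "f \<in> Hom a b \<Longrightarrow> f \<cdot> \<^bold>1 a = f"
    and ident_comp: "f \<in> Hom a b \<Longrightarrow> \<^bold>1 b \<cdot> f = f"
    and comp_assoc: "\<lbrakk>f \<in> Hom a b; g \<in> Hom b c; h \<in> Hom c d\<rbrakk> \<Longrightarrow> (h \<cdot> g) \<cdot> f = h \<cdot> (g \<cdot> f)"

definition inverse_arrows :: "('o, 'm, 'z) cat_scheme \<Rightarrow> 'm \<Rightarrow> 'm \<Rightarrow> bool"
  where "inverse_arrows C f g \<longleftrightarrow>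
    f \<in> arr C \<and> g \<in> Hom (tgt C f) (src C f) \<and> g \<cdot> f = \<^bold>1 (src C f) \<and> f \<cdot> g = \<^bold>1 (tgt C f)"
  for C (structure)

definition iso :: "('o, 'm, 'z) cat_scheme \<Rightarrow> 'm \<Rightarrow> bool"
  where "iso C f \<longleftrightarrow> (\<exists>g. inverse_arrows C f g)"

definition inv_arr :: "('o, 'm, 'z) cat_scheme \<Rightarrow> 'm \<Rightarrow> 'm"
  where "inv_arr C f = (THE g. inverse_arrows C f g)"


section \<open>Dagger symmetric monoidal categories\<close>

record ('o, 'm) dagger_smc = "('o, 'm) cat" +
  dag :: "'m \<Rightarrow> 'm"  (\<open>(_\<^sup>\<dagger>\<index>)\<close> [1000] 999)
  tens_obj :: "'o \<Rightarrow> 'o \<Rightarrow> 'o"  (infixr \<open>\<^bold>\<otimes>\<^sub>o\<index>\<close> 75)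
  tens :: "'m \<Rightarrow> 'm \<Rightarrow> 'm"  (infixr \<open>\<^bold>\<otimes>\<index>\<close> 75)
  unit :: "'o"  (\<open>\<^bold>I\<index>\<close>)
  assoc :: "'o \<Rightarrow> 'o \<Rightarrow> 'o \<Rightarrow> 'm"
  lunit :: "'o \<Rightarrow> 'm"
  runit :: "'o \<Rightarrow> 'm"
  braid :: "'o \<Rightarrow> 'o \<Rightarrow> 'm"

text \<open>
  The axioms \<open>lunit_unit\<close> and \<open>braid_unit\<close> follow from the other ones; they are listed, as in
  Mac Lane's definition, for convenience.
\<close>

locale symmetric_monoidal_category = category C
  for C :: "('o, 'm, 'z) dagger_smc_scheme" (structure) +
  assumes unit_obj: "\<^bold>I \<in> obj C"
    and tens_obj: "\<lbrakk>a \<in> obj C; b \<in> obj C\<rbrakk> \<Longrightarrow> a \<^bold>\<otimes>\<^sub>o b \<in> obj C"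
    and tens_hom: "\<lbrakk>f \<in> Hom a b; g \<in> Hom c d\<rbrakk> \<Longrightarrow> f \<^bold>\<otimes> g \<in> Hom (a \<^bold>\<otimes>\<^sub>o c) (b \<^bold>\<otimes>\<^sub>o d)"
    and tens_ident: "\<lbrakk>a \<in> obj C; b \<in> obj C\<rbrakk> \<Longrightarrow> \<^bold>1 a \<^bold>\<otimes> \<^bold>1 b = \<^bold>1 (a \<^bold>\<otimes>\<^sub>o b)"
    and tens_comp: "\<lbrakk>f \<in> Hom a b; g \<in> Hom b c; f' \<in> Hom a' b'; g' \<in> Hom b' c'\<rbrakk> \<Longrightarrow>
      (g \<cdot> f) \<^bold>\<otimes> (g' \<cdot> f') = (g \<^bold>\<otimes> g') \<cdot> (f \<^bold>\<otimes> f')"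
    and assoc_hom: "\<lbrakk>a \<in> obj C; b \<in> obj C; c \<in> obj C\<rbrakk> \<Longrightarrow>
      assoc C a b c \<in> Hom ((a \<^bold>\<otimes>\<^sub>o b) \<^bold>\<otimes>\<^sub>o c) (a \<^bold>\<otimes>\<^sub>o (b \<^bold>\<otimes>\<^sub>o c))"
    and assoc_iso: "\<lbrakk>a \<in> obj C; b \<in> obj C; c \<in> obj C\<rbrakk> \<Longrightarrow> iso C (assoc C a b c)"
    and assoc_natural: "\<lbrakk>f \<in> Hom a a'; g \<in> Hom b b'; h \<in> Hom c c'\<rbrakk> \<Longrightarrow>
      assoc C a' b' c' \<cdot> ((f \<^bold>\<otimes> g) \<^bold>\<otimes> h) = (f \<^bold>\<otimes> (g \<^bold>\<otimes> h)) \<cdot> assoc C a b c"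
    and lunit_hom: "a \<in> obj C \<Longrightarrow> lunit C a \<in> Hom (\<^bold>I \<^bold>\<otimes>\<^sub>o a) a"
    and lunit_iso: "a \<in> obj C \<Longrightarrow> iso C (lunit C a)"
    and lunit_natural: "f \<in> Hom a b \<Longrightarrow> lunit C b \<cdot> (\<^bold>1 \<^bold>I \<^bold>\<otimes> f) = f \<cdot> lunit C a"
    and runit_hom: "a \<in> obj C \<Longrightarrow> runit C a \<in> Hom (a \<^bold>\<otimes>\<^sub>o \<^bold>I) a"
    and runit_iso: "a \<in> obj C \<Longrightarrow> iso C (runit C a)"
    and runit_natural: "f \<in> Hom a b \<Longrightarrow> runit C b \<cdot> (f \<^bold>\<otimes> \<^bold>1 \<^bold>I) = f \<cdot> runit C a"
    and pentagon: "\<lbrakk>a \<in> obj C; b \<in> obj C; c \<in> obj C; d \<in> obj C\<rbrakk> \<Longrightarrow>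
      (\<^bold>1 a \<^bold>\<otimes> assoc C b c d) \<cdot> assoc C a (b \<^bold>\<otimes>\<^sub>o c) d \<cdot> (assoc C a b c \<^bold>\<otimes> \<^bold>1 d) =
      assoc C a b (c \<^bold>\<otimes>\<^sub>o d) \<cdot> assoc C (a \<^bold>\<otimes>\<^sub>o b) c d"
    and triangle: "\<lbrakk>a \<in> obj C; b \<in> obj C\<rbrakk> \<Longrightarrow>
      (\<^bold>1 a \<^bold>\<otimes> lunit C b) \<cdot> assoc C a \<^bold>I b = runit C a \<^bold>\<otimes> \<^bold>1 b"
    and lunit_unit: "lunit C \<^bold>I = runit C \<^bold>I"
    and braid_hom: "\<lbrakk>a \<in> obj C; b \<in> obj C\<rbrakk> \<Longrightarrow> braid C a b \<in> Hom (a \<^bold>\<otimes>\<^sub>o b) (b \<^bold>\<otimes>\<^sub>o a)"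
    and braid_natural: "\<lbrakk>f \<in> Hom a a'; g \<in> Hom b b'\<rbrakk> \<Longrightarrow>
      braid C a' b' \<cdot> (f \<^bold>\<otimes> g) = (g \<^bold>\<otimes> f) \<cdot> braid C a b"
    and braid_braid: "\<lbrakk>a \<in> obj C; b \<in> obj C\<rbrakk> \<Longrightarrow> braid C b a \<cdot> braid C a b = \<^bold>1 (a \<^bold>\<otimes>\<^sub>o b)"
    and hexagon: "\<lbrakk>a \<in> obj C; b \<in> obj C; c \<in> obj C\<rbrakk> \<Longrightarrow>
      assoc C b c a \<cdot> braid C a (b \<^bold>\<otimes>\<^sub>o c) \<cdot> assoc C a b c =
      (\<^bold>1 b \<^bold>\<otimes> braid C a c) \<cdot> assoc C b a c \<cdot> (braid C a b \<^bold>\<otimes> \<^bold>1 c)"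
    and braid_unit: "a \<in> obj C \<Longrightarrow> lunit C a \<cdot> braid C a \<^bold>I = runit C a"

definition unitary :: "('o, 'm, 'z) dagger_smc_scheme \<Rightarrow> 'm \<Rightarrow> bool"
  where "unitary C f \<longleftrightarrow> inverse_arrows C f (f\<^sup>\<dagger>)"
  for C (structure)

locale dagger_symmetric_monoidal_category = symmetric_monoidal_category C
  for C :: "('o, 'm, 'z) dagger_smc_scheme" (structure) +
  assumes dag_hom: "f \<in> Hom a b \<Longrightarrow> f\<^sup>\<dagger> \<in> Hom b a"
    and dag_ident: "a \<in> obj C \<Longrightarrow> (\<^bold>1 a)\<^sup>\<dagger> = \<^bold>1 a"
    and dag_comp: "\<lbrakk>f \<in> Hom a b; g \<in> Hom b c\<rbrakk> \<Longrightarrow> (g \<cdot> f)\<^sup>\<dagger> = f\<^sup>\<dagger> \<cdot> g\<^sup>\<dagger>"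
    and dag_dag: "f \<in> Hom a b \<Longrightarrow> (f\<^sup>\<dagger>)\<^sup>\<dagger> = f"
    and dag_tens: "\<lbrakk>f \<in> Hom a b; g \<in> Hom c d\<rbrakk> \<Longrightarrow> (f \<^bold>\<otimes> g)\<^sup>\<dagger> = f\<^sup>\<dagger> \<^bold>\<otimes> g\<^sup>\<dagger>"
    and unitary_assoc: "\<lbrakk>a \<in> obj C; b \<in> obj C; c \<in> obj C\<rbrakk> \<Longrightarrow> unitary C (assoc C a b c)"
    and unitary_lunit: "a \<in> obj C \<Longrightarrow> unitary C (lunit C a)"
    and unitary_runit: "a \<in> obj C \<Longrightarrow> unitary C (runit C a)"
    and unitary_braid: "\<lbrakk>a \<in> obj C; b \<in> obj C\<rbrakk> \<Longrightarrow> unitary C (braid C a b)"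


section \<open>Finite dagger biproducts\<close>

record ('o, 'm) dagger_smc_biprod = "('o, 'm) dagger_smc" +
  zero_obj :: "'o"
  biprod :: "'o \<Rightarrow> 'o \<Rightarrow> 'o"  (infixr \<open>\<^bold>\<oplus>\<^sub>o\<index>\<close> 65)
  inj1 :: "'o \<Rightarrow> 'o \<Rightarrow> 'm"
  inj2 :: "'o \<Rightarrow> 'o \<Rightarrow> 'm"
  proj1 :: "'o \<Rightarrow> 'o \<Rightarrow> 'm"
  proj2 :: "'o \<Rightarrow> 'o \<Rightarrow> 'm"

definition zero_arr :: "('o, 'm, 'z) dagger_smc_biprod_scheme \<Rightarrow> 'o \<Rightarrow> 'o \<Rightarrow> 'm"  (\<open>\<^bold>0\<index>\<close>)
  where "\<^bold>0 a b = (THE g. g \<in> Hom (zero_obj C) b) \<cdot> (THE f. f \<in> Hom a (zero_obj C))"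
  for C (structure)

locale dagger_smc_biproducts = dagger_symmetric_monoidal_category C
  for C :: "('o, 'm, 'z) dagger_smc_biprod_scheme" (structure) +
  assumes zero_obj: "zero_obj C \<in> obj C"
    and zero_initial: "a \<in> obj C \<Longrightarrow> \<exists>!f. f \<in> Hom (zero_obj C) a"
    and zero_terminal: "a \<in> obj C \<Longrightarrow> \<exists>!f. f \<in> Hom a (zero_obj C)"
    and biprod_obj: "\<lbrakk>a \<in> obj C; b \<in> obj C\<rbrakk> \<Longrightarrow> a \<^bold>\<oplus>\<^sub>o b \<in> obj C"
    and inj1_hom: "\<lbrakk>a \<in> obj C; b \<in> obj C\<rbrakk> \<Longrightarrow> inj1 C a b \<in> Hom a (a \<^bold>\<oplus>\<^sub>o b)"
    and inj2_hom: "\<lbrakk>a \<in> obj C; b \<in> obj C\<rbrakk> \<Longrightarrow> inj2 C a b \<in> Hom b (a \<^bold>\<oplus>\<^sub>o b)"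
    and proj1_hom: "\<lbrakk>a \<in> obj C; b \<in> obj C\<rbrakk> \<Longrightarrow> proj1 C a b \<in> Hom (a \<^bold>\<oplus>\<^sub>o b) a"
    and proj2_hom: "\<lbrakk>a \<in> obj C; b \<in> obj C\<rbrakk> \<Longrightarrow> proj2 C a b \<in> Hom (a \<^bold>\<oplus>\<^sub>o b) b"
    and coproduct: "\<lbrakk>f \<in> Hom a c; g \<in> Hom b c\<rbrakk> \<Longrightarrow>
      \<exists>!h. h \<in> Hom (a \<^bold>\<oplus>\<^sub>o b) c \<and> h \<cdot> inj1 C a b = f \<and> h \<cdot> inj2 C a b = g"
    and product: "\<lbrakk>f \<in> Hom c a; g \<in> Hom c b\<rbrakk> \<Longrightarrow>
      \<exists>!h. h \<in> Hom c (a \<^bold>\<oplus>\<^sub>o b) \<and> proj1 C a b \<cdot> h = f \<and> proj2 C a b \<cdot> h = g"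
    and proj1_inj1: "\<lbrakk>a \<in> obj C; b \<in> obj C\<rbrakk> \<Longrightarrow> proj1 C a b \<cdot> inj1 C a b = \<^bold>1 a"
    and proj2_inj2: "\<lbrakk>a \<in> obj C; b \<in> obj C\<rbrakk> \<Longrightarrow> proj2 C a b \<cdot> inj2 C a b = \<^bold>1 b"
    and proj1_inj2: "\<lbrakk>a \<in> obj C; b \<in> obj C\<rbrakk> \<Longrightarrow> proj1 C a b \<cdot> inj2 C a b = \<^bold>0 b a"
    and proj2_inj1: "\<lbrakk>a \<in> obj C; b \<in> obj C\<rbrakk> \<Longrightarrow> proj2 C a b \<cdot> inj1 C a b = \<^bold>0 a b"
    and dag_inj1: "\<lbrakk>a \<in> obj C; b \<in> obj C\<rbrakk> \<Longrightarrow> (inj1 C a b)\<^sup>\<dagger> = proj1 C a b"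
    and dag_inj2: "\<lbrakk>a \<in> obj C; b \<in> obj C\<rbrakk> \<Longrightarrow> (inj2 C a b)\<^sup>\<dagger> = proj2 C a b"

definition copair :: "('o, 'm, 'z) dagger_smc_biprod_scheme \<Rightarrow> 'm \<Rightarrow> 'm \<Rightarrow> 'm"
  where "copair C f g = (THE h. h \<in> Hom (src C f \<^bold>\<oplus>\<^sub>o src C g) (tgt C f) \<and>
    h \<cdot> inj1 C (src C f) (src C g) = f \<and> h \<cdot> inj2 C (src C f) (src C g) = g)"
  for C (structure)

definition pair :: "('o, 'm, 'z) dagger_smc_biprod_scheme \<Rightarrow> 'm \<Rightarrow> 'm \<Rightarrow> 'm"
  where "pair C f g = (THE h. h \<in> Hom (src C f) (tgt C f \<^bold>\<oplus>\<^sub>o tgt C g) \<and>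
    proj1 C (tgt C f) (tgt C g) \<cdot> h = f \<and> proj2 C (tgt C f) (tgt C g) \<cdot> h = g)"
  for C (structure)

definition codiagonal :: "('o, 'm, 'z) dagger_smc_biprod_scheme \<Rightarrow> 'o \<Rightarrow> 'm"  (\<open>\<nabla>\<index>\<close>)
  where "\<nabla> a = copair C (\<^bold>1 a) (\<^bold>1 a)"
  for C (structure)

definition diagonal :: "('o, 'm, 'z) dagger_smc_biprod_scheme \<Rightarrow> 'o \<Rightarrow> 'm"  (\<open>\<Delta>\<index>\<close>)
  where "\<Delta> a = pair C (\<^bold>1 a) (\<^bold>1 a)"
  for C (structure)

definition biprod_arr :: "('o, 'm, 'z) dagger_smc_biprod_scheme \<Rightarrow> 'm \<Rightarrow> 'm \<Rightarrow> 'm"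
    (infixr \<open>\<^bold>\<oplus>\<index>\<close> 65)
  where "f \<^bold>\<oplus> g =
    copair C (inj1 C (tgt C f) (tgt C g) \<cdot> f) (inj2 C (tgt C f) (tgt C g) \<cdot> g)"
  for C (structure)

definition add_arr :: "('o, 'm, 'z) dagger_smc_biprod_scheme \<Rightarrow> 'm \<Rightarrow> 'm \<Rightarrow> 'm"
  where "add_arr C f g = \<nabla> (tgt C f) \<cdot> (f \<^bold>\<oplus> g) \<cdot> \<Delta> (src C f)"
  for C (structure)


section \<open>Semialgebras with involution\<close>

text \<open>
  As for \<^const>\<open>ring_hom\<close>, the notions below refer to the operations only.  A set \<open>K\<close> of scalars
  is passed explicitly.
\<close>

record ('s, 'a) star_semialgebra = "('s, 'a) module" +
  star :: "'a \<Rightarrow> 'a"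

definition star_subsemialgebra :: "'s set \<Rightarrow> 'a set \<Rightarrow> ('s, 'a, 'z) star_semialgebra_scheme \<Rightarrow> bool"
  where "star_subsemialgebra K H A \<longleftrightarrow>
    H \<subseteq> carrier A \<and> \<zero> \<in> H \<and> \<one> \<in> H \<and>
    (\<forall>x\<in>H. \<forall>y\<in>H. x \<oplus> y \<in> H \<and> x \<otimes> y \<in> H) \<and>
    (\<forall>s\<in>K. \<forall>x\<in>H. s \<odot> x \<in> H) \<and>
    (\<forall>x\<in>H. star A x \<in> H)"
  for A (structure)

definition star_semialgebra_hom ::
    "'s set \<Rightarrow> ('s, 'a, 'z) star_semialgebra_scheme \<Rightarrow> ('s, 'b, 'y) star_semialgebra_scheme \<Rightarrow>
     ('a \<Rightarrow> 'b) set"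
  where "star_semialgebra_hom K A B = {h \<in> ring_hom A B.
    h \<zero>\<^bsub>A\<^esub> = \<zero>\<^bsub>B\<^esub> \<and>
    (\<forall>s\<in>K. \<forall>x\<in>carrier A. h (s \<odot>\<^bsub>A\<^esub> x) = s \<odot>\<^bsub>B\<^esub> h x) \<and>
    (\<forall>x\<in>carrier A. h (star A x) = star B (h x))}"

definition scalars :: "('o, 'm, 'z) dagger_smc_scheme \<Rightarrow> 'm set"
  where "scalars C = Hom \<^bold>I \<^bold>I"
  for C (structure)

text \<open>
  For \<open>X\<close> the monoidal unit this is the semiring of scalars as a semialgebra over itself: there
  the scalar action coincides with multiplication.
\<close>

definition End_semialgebra ::
    "('o, 'm, 'z) dagger_smc_biprod_scheme \<Rightarrow> 'o \<Rightarrow> ('m, 'm) star_semialgebra"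
  where "End_semialgebra C X =
    \<lparr>carrier = Hom X X, mult = (\<lambda>f g. f \<cdot> g), one = \<^bold>1 X, zero = \<^bold>0 X X, add = add_arr C,
     smult = (\<lambda>s f. runit C X \<cdot> (f \<^bold>\<otimes> s) \<cdot> inv_arr C (runit C X)), star = (\<lambda>f. f\<^sup>\<dagger>)\<rparr>"
  for C (structure)


section \<open>H*-algebras\<close>

definition R_op :: "('o, 'm, 'z) dagger_smc_scheme \<Rightarrow> 'o \<Rightarrow> 'm \<Rightarrow> 'm \<Rightarrow> 'm"
  where "R_op C X \<mu> x = \<mu> \<cdot> (x \<^bold>\<otimes> \<^bold>1 X) \<cdot> inv_arr C (lunit C X)"
  for C (structure)

text \<open>The copoint \<open>y\<close> is a possible choice of \<open>x\<close> with a tilde in condition (H).\<close>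

definition H_copoint :: "('o, 'm, 'z) dagger_smc_scheme \<Rightarrow> 'o \<Rightarrow> 'm \<Rightarrow> 'm \<Rightarrow> 'm \<Rightarrow> bool"
  where "H_copoint C X \<mu> x y \<longleftrightarrow>
    y \<in> Hom X \<^bold>I \<and> R_op C X \<mu> x = runit C X \<cdot> (\<^bold>1 X \<^bold>\<otimes> y) \<cdot> \<mu>\<^sup>\<dagger>"
  for C (structure)

definition H_star_algebra :: "('o, 'm, 'z) dagger_smc_scheme \<Rightarrow> 'o \<Rightarrow> 'm \<Rightarrow> bool"
  where "H_star_algebra C X \<mu> \<longleftrightarrow>
    X \<in> obj C \<and> \<mu> \<in> Hom (X \<^bold>\<otimes>\<^sub>o X) X \<and>
    \<mu> \<cdot> (\<mu> \<^bold>\<otimes> \<^bold>1 X) = \<mu> \<cdot> (\<^bold>1 X \<^bold>\<otimes> \<mu>) \<cdot> assoc C X X X \<and>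
    \<mu> \<cdot> braid C X X = \<mu> \<and>
    \<mu> \<cdot> \<mu>\<^sup>\<dagger> = \<^bold>1 X \<and>
    (\<forall>x\<in>Hom \<^bold>I X. \<exists>y. H_copoint C X \<mu> x y)"
  for C (structure)

definition R_set :: "('o, 'm, 'z) dagger_smc_scheme \<Rightarrow> 'o \<Rightarrow> 'm \<Rightarrow> 'm set"
  where "R_set C X \<mu> = {R_op C X \<mu> x | x. x \<in> Hom \<^bold>I X}"
  for C (structure)

definition commutant :: "('o, 'm, 'z) cat_scheme \<Rightarrow> 'o \<Rightarrow> 'm set \<Rightarrow> 'm set"
  where "commutant C X R = {f \<in> Hom X X. \<forall>g\<in>R. f \<cdot> g = g \<cdot> f}"
  for C (structure)

definition von_Neumann_semialgebra ::
    "('o, 'm, 'z) dagger_smc_biprod_scheme \<Rightarrow> 'o \<Rightarrow> 'm \<Rightarrow> ('m, 'm) star_semialgebra"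
  where "von_Neumann_semialgebra C X \<mu> =
    (End_semialgebra C X)\<lparr>carrier := commutant C X (R_set C X \<mu>)\<rparr>"

definition set_likes :: "('o, 'm, 'z) dagger_smc_scheme \<Rightarrow> 'o \<Rightarrow> 'm \<Rightarrow> 'm set"
  where "set_likes C X \<mu> = {\<alpha> \<in> Hom \<^bold>I X.
    \<mu>\<^sup>\<dagger> \<cdot> \<alpha> = (\<alpha> \<^bold>\<otimes> \<alpha>) \<cdot> inv_arr C (lunit C \<^bold>I) \<and> H_copoint C X \<mu> \<alpha> (\<alpha>\<^sup>\<dagger>)}"
  for C (structure)

definition orthonormal :: "('o, 'm, 'z) dagger_smc_biprod_scheme \<Rightarrow> 'm set \<Rightarrow> bool"
  where "orthonormal C A \<longleftrightarrow>
    (\<forall>\<alpha>\<in>A. \<forall>\<beta>\<in>A. \<beta>\<^sup>\<dagger> \<cdot> \<alpha> = (if \<alpha> = \<beta> then \<^bold>1 \<^bold>I else \<^bold>0 \<^bold>I \<^bold>I))"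
  for C (structure)

end

theory Submission
  imports Defs
begin

text \<open>
  Elements of the commutant satisfy \<open>f (\<mu> (x \<otimes> y)) = \<mu> (x \<otimes> f y) = \<mu> (f x \<otimes> y)\<close> on points.  A set-like
  \<open>\<alpha>\<close> is idempotent by speciality, \<open>\<mu> (\<alpha> \<otimes> \<alpha>) = \<mu> \<mu>\<^sup>\<dagger> \<alpha> = \<alpha>\<close>, hence \<open>f g \<alpha> = \<mu> (f \<alpha> \<otimes> g \<alpha>)\<close>; as the
  adjoint of the set-like condition reads \<open>\<alpha>\<^sup>\<dagger> \<mu> = \<alpha>\<^sup>\<dagger> \<otimes> \<alpha>\<^sup>\<dagger>\<close>, the map \<open>f \<mapsto> \<alpha>\<^sup>\<dagger> f \<alpha>\<close> is multiplicative.
  The commutant is closed under the dagger because condition (H) says that \<open>R(\<mu>)\<close> is.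
\<close>

section \<open>Categories\<close>

lemma homD:
  assumes "f \<in> hom C a b"
  shows "f \<in> arr C" "src C f = a" "tgt C f = b"
  using assms by (auto simp: hom_def)

context category
begin

lemma hom_obj:
  assumes "f \<in> Hom a b"
  shows "a \<in> obj C" "b \<in> obj C"
  using assms src_obj tgt_obj by (auto simp: hom_def)

text \<open>Unlike the axioms \<open>comp_hom\<close> and \<open>comp_assoc\<close>, these rules have no schematic objects in their premises,
  so that the simplifier can apply them.\<close>

lemma arr_comp:
  assumes "f \<in> arr C" "g \<in> arr C" "tgt C f = src C g"
  shows "g \<cdot> f \<in> arr C" "src C (g \<cdot> f) = src C f" "tgt C (g \<cdot> f) = tgt C g"
    "h \<in> arr C \<Longrightarrow> tgt C g = src C h \<Longrightarrow> (h \<cdot> g) \<cdot> f = h \<cdot> g \<cdot> f"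
  using assms comp_hom[of f "src C f" "src C g" g "tgt C g"]
    comp_assoc[of f "src C f" "src C g" g "src C h" h "tgt C h"]
  by (auto simp: hom_def)

text \<open>Inverses are unique, so the definite description picks whichever inverse can be
  exhibited; for the structure isomorphisms this will be the dagger.\<close>

lemma inv_arr_eq:
  assumes "inverse_arrows C f g"
  shows "inv_arr C f = g"
  unfolding inv_arr_def
proof (rule the_equality)
  fix g' assume g': "inverse_arrows C f g'"
  have f: "f \<in> Hom (src C f) (tgt C f)"
    using assms by (simp add: inverse_arrows_def hom_def)
  have h: "g \<in> Hom (tgt C f) (src C f)" "g' \<in> Hom (tgt C f) (src C f)"
    using assms g' by (simp_all add: inverse_arrows_def)
  have "g' = (g \<cdot> f) \<cdot> g'"
    using assms ident_comp[OF h(2)] by (simp add: inverse_arrows_def)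
  also have "\<dots> = g \<cdot> (f \<cdot> g')"
    by (rule comp_assoc[OF h(2) f h(1)])
  also have "\<dots> = g"
    using g' comp_ident[OF h(1)] by (simp add: inverse_arrows_def)
  finally show "g' = g" .
qed (rule assms)

section \<open>Commutants of sets of endomorphisms\<close>

lemma commutantI:
  assumes "f \<in> Hom X X" "\<And>g. g \<in> R \<Longrightarrow> f \<cdot> g = g \<cdot> f"
  shows "f \<in> commutant C X R"
  using assms by (simp add: commutant_def)

lemma commutantD:
  assumes "f \<in> commutant C X R"
  shows "f \<in> Hom X X" "\<And>g. g \<in> R \<Longrightarrow> f \<cdot> g = g \<cdot> f"
  using assms by (simp_all add: commutant_def)

lemma ident_commutant:
  assumes "X \<in> obj C" "R \<subseteq> Hom X X"
  shows "\<^bold>1 X \<in> commutant C X R"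
  using assms by (auto intro!: commutantI ident_hom simp: comp_ident ident_comp subset_iff)

lemma comp_commutant:
  assumes "R \<subseteq> Hom X X" "f \<in> commutant C X R" "g \<in> commutant C X R"
  shows "f \<cdot> g \<in> commutant C X R"
proof (rule commutantI)
  note f = commutantD[OF assms(2)] and g = commutantD[OF assms(3)]
  show "f \<cdot> g \<in> Hom X X" using f g by (blast intro: comp_hom)
  fix h assume h: "h \<in> R"
  then have hX: "h \<in> Hom X X" using assms by blast
  have "(f \<cdot> g) \<cdot> h = f \<cdot> h \<cdot> g"
    by (simp add: comp_assoc[OF hX g(1) f(1)] g(2)[OF h])
  also have "\<dots> = h \<cdot> f \<cdot> g"
    by (simp add: comp_assoc[OF g(1) hX f(1), symmetric] f(2)[OF h] comp_assoc[OF g(1) f(1) hX])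
  finally show "(f \<cdot> g) \<cdot> h = h \<cdot> f \<cdot> g" .
qed

end

section \<open>Dagger symmetric monoidal categories\<close>

context dagger_symmetric_monoidal_category
begin

lemma unitaryD:
  assumes "unitary C u" "u \<in> Hom a b"
  shows "inv_arr C u = u\<^sup>\<dagger>" "u\<^sup>\<dagger> \<in> Hom b a" "u\<^sup>\<dagger> \<cdot> u = \<^bold>1 a" "u \<cdot> u\<^sup>\<dagger> = \<^bold>1 b"
  using assms inv_arr_eq[of u "u\<^sup>\<dagger>"] by (auto simp: unitary_def inverse_arrows_def hom_def)

lemmas lunit_dag = unitaryD[OF unitary_lunit lunit_hom]
lemmas runit_dag = unitaryD[OF unitary_runit runit_hom]
lemmas braid_dag = unitaryD[OF unitary_braid braid_hom]

text \<open>Adjoint of the naturality of \<open>lunit\<close> at the adjoint of \<open>f\<close>; by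
  unitarity it is the naturality of the inverse unitor.\<close>

lemma lunit_dag_natural:
  assumes f: "f \<in> Hom a b"
  shows "(lunit C b)\<^sup>\<dagger> \<cdot> f = (\<^bold>1 \<^bold>I \<^bold>\<otimes> f) \<cdot> (lunit C a)\<^sup>\<dagger>"
proof -
  note o = hom_obj[OF f]
  have "(lunit C a \<cdot> (\<^bold>1 \<^bold>I \<^bold>\<otimes> f\<^sup>\<dagger>))\<^sup>\<dagger> = (f\<^sup>\<dagger> \<cdot> lunit C b)\<^sup>\<dagger>"
    using lunit_natural[OF dag_hom[OF f]] by simp
  then show ?thesis
    using dag_comp[OF tens_hom[OF ident_hom[OF unit_obj] dag_hom[OF f]] lunit_hom[OF o(1)]]
      dag_comp[OF lunit_hom[OF o(2)] dag_hom[OF f]]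
      dag_tens[OF ident_hom[OF unit_obj] dag_hom[OF f]]
    by (simp add: dag_ident unit_obj dag_dag[OF f])
qed

lemma runit_dag_natural:
  assumes f: "f \<in> Hom a b"
  shows "(runit C b)\<^sup>\<dagger> \<cdot> f = (f \<^bold>\<otimes> \<^bold>1 \<^bold>I) \<cdot> (runit C a)\<^sup>\<dagger>"
proof -
  note o = hom_obj[OF f]
  have "(runit C a \<cdot> (f\<^sup>\<dagger> \<^bold>\<otimes> \<^bold>1 \<^bold>I))\<^sup>\<dagger> = (f\<^sup>\<dagger> \<cdot> runit C b)\<^sup>\<dagger>"
    using runit_natural[OF dag_hom[OF f]] by simp
  then show ?thesis
    using dag_comp[OF tens_hom[OF dag_hom[OF f] ident_hom[OF unit_obj]] runit_hom[OF o(1)]]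
      dag_comp[OF runit_hom[OF o(2)] dag_hom[OF f]]
      dag_tens[OF dag_hom[OF f] ident_hom[OF unit_obj]]
    by (simp add: dag_ident unit_obj dag_dag[OF f])
qed

section \<open>The scalar action and further closure properties of commutants\<close>

lemma smult_hom:
  assumes "s \<in> Hom \<^bold>I \<^bold>I" "f \<in> Hom X X"
  shows "runit C X \<cdot> (f \<^bold>\<otimes> s) \<cdot> inv_arr C (runit C X) \<in> Hom X X"
proof -
  note X = hom_obj(1)[OF assms(2)]
  show ?thesis
    unfolding runit_dag(1)[OF X X]
    by (rule comp_hom[OF comp_hom[OF runit_dag(2)[OF X X] tens_hom[OF assms(2,1)]] runit_hom[OF X]])
qed

text \<open>Naturality of \<open>runit\<close> and of its dagger carries \<open>g\<close> and
  \<open>h\<close> into the tensor product, where the interchange law merges them with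
  \<open>f\<close>. Taking one of them to be an identity gives closure of commutants under scalars;
  taking a point and its adjoint gives homogeneity of the map in the theorem.\<close>

lemma comp_smult_comp:
  assumes s: "s \<in> Hom \<^bold>I \<^bold>I" and f: "f \<in> Hom a a" and g: "g \<in> Hom a b" and h: "h \<in> Hom b a"
  shows "g \<cdot> (runit C a \<cdot> (f \<^bold>\<otimes> s) \<cdot> inv_arr C (runit C a)) \<cdot> h =
    runit C b \<cdot> ((g \<cdot> f \<cdot> h) \<^bold>\<otimes> s) \<cdot> inv_arr C (runit C b)"
proof -
  note o = hom_obj[OF g]
  note I = ident_hom[OF unit_obj]
  note r = runit_hom[OF o(1)] runit_hom[OF o(2)] runit_dag(2)[OF o(1) o(1)] runit_dag(2)[OF o(2) o(2)]
  note fs = tens_hom[OF f s] and gI = tens_hom[OF g I] and hI = tens_hom[OF h I]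
  have "g \<cdot> (runit C a \<cdot> (f \<^bold>\<otimes> s) \<cdot> (runit C a)\<^sup>\<dagger>) \<cdot> h =
    (g \<cdot> runit C a) \<cdot> (f \<^bold>\<otimes> s) \<cdot> ((runit C a)\<^sup>\<dagger> \<cdot> h)"
    using g h r fs by (simp add: hom_def arr_comp)
  also have "\<dots> = (runit C b \<cdot> (g \<^bold>\<otimes> \<^bold>1 \<^bold>I)) \<cdot> (f \<^bold>\<otimes> s) \<cdot> ((h \<^bold>\<otimes> \<^bold>1 \<^bold>I) \<cdot> (runit C b)\<^sup>\<dagger>)"
    by (simp add: runit_natural[OF g] runit_dag_natural[OF h])
  also have "\<dots> = runit C b \<cdot> ((g \<^bold>\<otimes> \<^bold>1 \<^bold>I) \<cdot> (f \<^bold>\<otimes> s) \<cdot> (h \<^bold>\<otimes> \<^bold>1 \<^bold>I)) \<cdot> (runit C b)\<^sup>\<dagger>"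
    using gI hI r fs by (simp add: hom_def arr_comp)
  also have "(g \<^bold>\<otimes> \<^bold>1 \<^bold>I) \<cdot> (f \<^bold>\<otimes> s) \<cdot> (h \<^bold>\<otimes> \<^bold>1 \<^bold>I) = (g \<cdot> f \<cdot> h) \<^bold>\<otimes> s"
    using f g h s I
    by (simp add: tens_comp[OF h f I s, symmetric] comp_ident[OF s] ident_comp[OF s]
        tens_comp[OF comp_hom[OF h f] g s I, symmetric])
  finally show ?thesis
    using o by (simp add: runit_dag(1))
qed

text \<open>An Eckmann-Hilton argument: \<open>s\<close> slides out on the left by naturality of the
  right unitor, which agrees with the left one at the unit object, and \<open>t\<close> slides out
  on the right by naturality of the inverse left unitor.\<close>

lemma lunit_tens_scalars:
  assumes s: "s \<in> Hom \<^bold>I \<^bold>I" and t: "t \<in> Hom \<^bold>I \<^bold>I"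
  shows "lunit C \<^bold>I \<cdot> (s \<^bold>\<otimes> t) \<cdot> (lunit C \<^bold>I)\<^sup>\<dagger> = s \<cdot> t"
proof -
  note I = ident_hom[OF unit_obj]
  note l = lunit_hom[OF unit_obj] lunit_dag(2)[OF unit_obj unit_obj]
  note st = tens_hom[OF s I] tens_hom[OF I t]
  have "s \<^bold>\<otimes> t = (s \<^bold>\<otimes> \<^bold>1 \<^bold>I) \<cdot> (\<^bold>1 \<^bold>I \<^bold>\<otimes> t)"
    by (simp add: tens_comp[OF I s t I, symmetric] comp_ident[OF s] ident_comp[OF t])
  then have "lunit C \<^bold>I \<cdot> (s \<^bold>\<otimes> t) \<cdot> (lunit C \<^bold>I)\<^sup>\<dagger> =
    (lunit C \<^bold>I \<cdot> (s \<^bold>\<otimes> \<^bold>1 \<^bold>I)) \<cdot> ((\<^bold>1 \<^bold>I \<^bold>\<otimes> t) \<cdot> (lunit C \<^bold>I)\<^sup>\<dagger>)"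
    using l st by (simp add: hom_def arr_comp)
  also have "\<dots> = (s \<cdot> lunit C \<^bold>I) \<cdot> ((lunit C \<^bold>I)\<^sup>\<dagger> \<cdot> t)"
    using runit_natural[OF s] lunit_dag_natural[OF t] by (simp add: lunit_unit)
  also have "\<dots> = s \<cdot> (lunit C \<^bold>I \<cdot> (lunit C \<^bold>I)\<^sup>\<dagger>) \<cdot> t"
    using l s t by (simp add: hom_def arr_comp)
  also have "\<dots> = s \<cdot> t"
    by (simp add: lunit_dag(4) unit_obj ident_comp[OF t])
  finally show ?thesis .
qed

lemma smult_commutant:
  assumes R: "R \<subseteq> Hom X X" and s: "s \<in> Hom \<^bold>I \<^bold>I" and f: "f \<in> commutant C X R"
  shows "runit C X \<cdot> (f \<^bold>\<otimes> s) \<cdot> inv_arr C (runit C X) \<in> commutant C X R" (is "?sf \<in> _")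
proof (rule commutantI)
  note fX = commutantD(1)[OF f]
  note X = hom_obj(1)[OF fX]
  show sf: "?sf \<in> Hom X X" by (rule smult_hom[OF s fX])
  fix g assume g: "g \<in> R"
  then have gX: "g \<in> Hom X X" using R by blast
  \<comment> \<open>\<open>comp_smult_comp\<close> is used with an identity as the left outer
    factor, and further below with an identity as the right one.\<close>
  have "?sf \<cdot> g = runit C X \<cdot> ((f \<cdot> g) \<^bold>\<otimes> s) \<cdot> inv_arr C (runit C X)"
    using comp_smult_comp[OF s fX ident_hom[OF X] gX]
    by (simp add: ident_comp[OF comp_hom[OF gX sf]] ident_comp[OF comp_hom[OF gX fX]])
  also have "\<dots> = runit C X \<cdot> ((g \<cdot> f) \<^bold>\<otimes> s) \<cdot> inv_arr C (runit C X)"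
    using commutantD(2)[OF f g] by simp
  also have "\<dots> = g \<cdot> ?sf"
    using comp_smult_comp[OF s fX gX ident_hom[OF X]]
    by (simp add: comp_ident[OF fX] comp_ident[OF sf])
  finally show "?sf \<cdot> g = g \<cdot> ?sf" .
qed

text \<open>\<open>f\<close> commutes with the adjoint of \<open>g\<close>, which again lies in
  \<open>R\<close>; taking adjoints of that equation gives the claim.\<close>

lemma dag_commutant:
  assumes R: "R \<subseteq> Hom X X" and dag: "\<And>g. g \<in> R \<Longrightarrow> g\<^sup>\<dagger> \<in> R" and f: "f \<in> commutant C X R"
  shows "f\<^sup>\<dagger> \<in> commutant C X R"
proof (rule commutantI)
  note fX = commutantD(1)[OF f]
  show "f\<^sup>\<dagger> \<in> Hom X X" by (rule dag_hom[OF fX])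
  fix g assume g: "g \<in> R"
  then have gX: "g \<in> Hom X X" using R by blast
  note g'X = dag_hom[OF gX]
  have "(f \<cdot> g\<^sup>\<dagger>)\<^sup>\<dagger> = (g\<^sup>\<dagger> \<cdot> f)\<^sup>\<dagger>"
    using commutantD(2)[OF f dag[OF g]] by simp
  then show "f\<^sup>\<dagger> \<cdot> g = g \<cdot> f\<^sup>\<dagger>"
    by (simp add: dag_comp[OF g'X fX] dag_comp[OF fX g'X] dag_dag[OF gX])
qed

end

section \<open>Addition of arrows\<close>

context dagger_smc_biproducts
begin

section \<open>Zero arrows\<close>

lemma zero_arr_hom:
  assumes "a \<in> obj C" "b \<in> obj C"
  shows "\<^bold>0 a b \<in> Hom a b"
  unfolding zero_arr_def
  by (rule comp_hom[OF theI'[OF zero_terminal[OF assms(1)]] theI'[OF zero_initial[OF assms(2)]]])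

text \<open>\<open>f\<close> after the unique arrow out of the zero object is again the unique such
  arrow.\<close>

lemma comp_zero:
  assumes "a \<in> obj C" "f \<in> Hom b c"
  shows "f \<cdot> \<^bold>0 a b = \<^bold>0 a c"
proof -
  note b = hom_obj[OF assms(2)]
  note i = theI'[OF zero_initial[OF b(1)]] and t = theI'[OF zero_terminal[OF assms(1)]]
  have "f \<cdot> (THE g. g \<in> Hom (zero_obj C) b) = (THE g. g \<in> Hom (zero_obj C) c)"
    by (rule the1_equality[OF zero_initial[OF b(2)] comp_hom[OF i assms(2)], symmetric])
  then show ?thesis
    unfolding zero_arr_def using comp_assoc[OF t i assms(2)] by simp
qed

lemma zero_comp:
  assumes "c \<in> obj C" "f \<in> Hom a b"
  shows "\<^bold>0 b c \<cdot> f = \<^bold>0 a c"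
proof -
  note b = hom_obj[OF assms(2)]
  note i = theI'[OF zero_initial[OF assms(1)]] and t = theI'[OF zero_terminal[OF b(2)]]
  have "(THE g. g \<in> Hom b (zero_obj C)) \<cdot> f = (THE g. g \<in> Hom a (zero_obj C))"
    by (rule the1_equality[OF zero_terminal[OF b(1)] comp_hom[OF assms(2) t], symmetric])
  then show ?thesis
    unfolding zero_arr_def using comp_assoc[OF assms(2) t i] by simp
qed

section \<open>Pairing, copairing and biproducts of arrows\<close>

lemma copair_props:
  assumes f: "f \<in> Hom a c" and g: "g \<in> Hom b c"
  shows "copair C f g \<in> Hom (a \<^bold>\<oplus>\<^sub>o b) c" "copair C f g \<cdot> inj1 C a b = f"
    "copair C f g \<cdot> inj2 C a b = g"
  using theI'[OF coproduct[OF f g]] homD[OF f] homD[OF g] unfolding copair_def by simp_all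

lemma pair_props:
  assumes f: "f \<in> Hom c a" and g: "g \<in> Hom c b"
  shows "pair C f g \<in> Hom c (a \<^bold>\<oplus>\<^sub>o b)" "proj1 C a b \<cdot> pair C f g = f"
    "proj2 C a b \<cdot> pair C f g = g"
  using theI'[OF product[OF f g]] homD[OF f] homD[OF g] unfolding pair_def by simp_all

lemma copair_ext:
  assumes o: "a \<in> obj C" "b \<in> obj C"
    and h: "h \<in> Hom (a \<^bold>\<oplus>\<^sub>o b) c" and k: "k \<in> Hom (a \<^bold>\<oplus>\<^sub>o b) c"
    and eq: "h \<cdot> inj1 C a b = k \<cdot> inj1 C a b" "h \<cdot> inj2 C a b = k \<cdot> inj2 C a b"
  shows "h = k"
  using coproduct[OF comp_hom[OF inj1_hom[OF o] h] comp_hom[OF inj2_hom[OF o] h]] h k eq by metis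

lemma pair_ext:
  assumes o: "a \<in> obj C" "b \<in> obj C"
    and h: "h \<in> Hom c (a \<^bold>\<oplus>\<^sub>o b)" and k: "k \<in> Hom c (a \<^bold>\<oplus>\<^sub>o b)"
    and eq: "proj1 C a b \<cdot> h = proj1 C a b \<cdot> k" "proj2 C a b \<cdot> h = proj2 C a b \<cdot> k"
  shows "h = k"
  using product[OF comp_hom[OF h proj1_hom[OF o]] comp_hom[OF h proj2_hom[OF o]]] h k eq by metis

lemma comp_copair:
  assumes f: "f \<in> Hom a c" and g: "g \<in> Hom b c" and h: "h \<in> Hom c d"
  shows "h \<cdot> copair C f g = copair C (h \<cdot> f) (h \<cdot> g)"
proof -
  note o = hom_obj(1)[OF f] hom_obj(1)[OF g]
  note p = copair_props[OF f g] and q = copair_props[OF comp_hom[OF f h] comp_hom[OF g h]]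
  show ?thesis
    by (rule copair_ext[OF o comp_hom[OF p(1) h] q(1)])
      (simp_all add: comp_assoc[OF inj1_hom[OF o] p(1) h] comp_assoc[OF inj2_hom[OF o] p(1) h] p q)
qed

lemma pair_comp:
  assumes f: "f \<in> Hom c a" and g: "g \<in> Hom c b" and h: "h \<in> Hom d c"
  shows "pair C f g \<cdot> h = pair C (f \<cdot> h) (g \<cdot> h)"
proof -
  note o = hom_obj(2)[OF f] hom_obj(2)[OF g]
  note p = pair_props[OF f g] and q = pair_props[OF comp_hom[OF h f] comp_hom[OF h g]]
  show ?thesis
    by (rule pair_ext[OF o comp_hom[OF h p(1)] q(1)])
      (simp_all add: comp_assoc[OF h p(1) proj1_hom[OF o], symmetric]
        comp_assoc[OF h p(1) proj2_hom[OF o], symmetric] p q)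
qed

text \<open>Although defined as a copairing, the biproduct of arrows is also the product map: the
  two projection equations are tested on both injections, where each side reduces to an arrow or to
  a zero arrow.\<close>

lemma biprod_arr_props:
  assumes f: "f \<in> Hom a b" and g: "g \<in> Hom a' b'"
  shows "f \<^bold>\<oplus> g \<in> Hom (a \<^bold>\<oplus>\<^sub>o a') (b \<^bold>\<oplus>\<^sub>o b')"
    "(f \<^bold>\<oplus> g) \<cdot> inj1 C a a' = inj1 C b b' \<cdot> f" "(f \<^bold>\<oplus> g) \<cdot> inj2 C a a' = inj2 C b b' \<cdot> g"
    "proj1 C b b' \<cdot> (f \<^bold>\<oplus> g) = f \<cdot> proj1 C a a'" "proj2 C b b' \<cdot> (f \<^bold>\<oplus> g) = g \<cdot> proj2 C a a'"
proof -
  note o = hom_obj(1)[OF f] hom_obj(1)[OF g] and o' = hom_obj(2)[OF f] hom_obj(2)[OF g]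
  note i = inj1_hom[OF o] inj2_hom[OF o] and i' = inj1_hom[OF o'] inj2_hom[OF o']
  note p = proj1_hom[OF o] proj2_hom[OF o] and p' = proj1_hom[OF o'] proj2_hom[OF o']
  note c = copair_props[OF comp_hom[OF f i'(1)] comp_hom[OF g i'(2)]]
  have eq: "f \<^bold>\<oplus> g = copair C (inj1 C b b' \<cdot> f) (inj2 C b b' \<cdot> g)"
    by (simp add: biprod_arr_def homD[OF f] homD[OF g])
  show h: "f \<^bold>\<oplus> g \<in> Hom (a \<^bold>\<oplus>\<^sub>o a') (b \<^bold>\<oplus>\<^sub>o b')"
    and 1: "(f \<^bold>\<oplus> g) \<cdot> inj1 C a a' = inj1 C b b' \<cdot> f"
    and 2: "(f \<^bold>\<oplus> g) \<cdot> inj2 C a a' = inj2 C b b' \<cdot> g"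
    using c by (simp_all add: eq)
  show "proj1 C b b' \<cdot> (f \<^bold>\<oplus> g) = f \<cdot> proj1 C a a'"
  proof (rule copair_ext[OF o comp_hom[OF h p'(1)] comp_hom[OF p(1) f]])
    show "(proj1 C b b' \<cdot> (f \<^bold>\<oplus> g)) \<cdot> inj1 C a a' = (f \<cdot> proj1 C a a') \<cdot> inj1 C a a'"
      by (simp add: comp_assoc[OF i(1) h p'(1)] 1 comp_assoc[OF f i'(1) p'(1), symmetric]
          comp_assoc[OF i(1) p(1) f] proj1_inj1 o o' comp_ident[OF f] ident_comp[OF f])
    show "(proj1 C b b' \<cdot> (f \<^bold>\<oplus> g)) \<cdot> inj2 C a a' = (f \<cdot> proj1 C a a') \<cdot> inj2 C a a'"
      by (simp add: comp_assoc[OF i(2) h p'(1)] 2 comp_assoc[OF g i'(2) p'(1), symmetric]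
          comp_assoc[OF i(2) p(1) f] proj1_inj2 o o' comp_zero[OF o(2) f] zero_comp[OF o'(1) g])
  qed
  show "proj2 C b b' \<cdot> (f \<^bold>\<oplus> g) = g \<cdot> proj2 C a a'"
  proof (rule copair_ext[OF o comp_hom[OF h p'(2)] comp_hom[OF p(2) g]])
    show "(proj2 C b b' \<cdot> (f \<^bold>\<oplus> g)) \<cdot> inj1 C a a' = (g \<cdot> proj2 C a a') \<cdot> inj1 C a a'"
      by (simp add: comp_assoc[OF i(1) h p'(2)] 1 comp_assoc[OF f i'(1) p'(2), symmetric]
          comp_assoc[OF i(1) p(2) g] proj2_inj1 o o' comp_zero[OF o(1) g] zero_comp[OF o'(2) f])
    show "(proj2 C b b' \<cdot> (f \<^bold>\<oplus> g)) \<cdot> inj2 C a a' = (g \<cdot> proj2 C a a') \<cdot> inj2 C a a'"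
      by (simp add: comp_assoc[OF i(2) h p'(2)] 2 comp_assoc[OF g i'(2) p'(2), symmetric]
          comp_assoc[OF i(2) p(2) g] proj2_inj2 o o' comp_ident[OF g] ident_comp[OF g])
  qed
qed

lemma codiagonal_biprod_arr:
  assumes f: "f \<in> Hom a b" and g: "g \<in> Hom a' b"
  shows "\<nabla> b \<cdot> (f \<^bold>\<oplus> g) = copair C f g"
proof -
  note o = hom_obj(1)[OF f] hom_obj(1)[OF g]
  note b = hom_obj(2)[OF f]
  note d = copair_props[OF ident_hom[OF b] ident_hom[OF b], folded codiagonal_def]
  note h = biprod_arr_props[OF f g] and c = copair_props[OF f g]
  note i = inj1_hom[OF o] inj2_hom[OF o] inj1_hom[OF b b] inj2_hom[OF b b]
  show ?thesis
    by (rule copair_ext[OF o comp_hom[OF h(1) d(1)] c(1)])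
      (simp_all add: comp_assoc[OF i(1) h(1) d(1)] comp_assoc[OF i(2) h(1) d(1)] h c
        comp_assoc[OF f i(3) d(1), symmetric] comp_assoc[OF g i(4) d(1), symmetric] d
        ident_comp[OF f] ident_comp[OF g])
qed

lemma biprod_arr_diagonal:
  assumes f: "f \<in> Hom a b" and g: "g \<in> Hom a b'"
  shows "(f \<^bold>\<oplus> g) \<cdot> \<Delta> a = pair C f g"
proof -
  note o = hom_obj(2)[OF f] hom_obj(2)[OF g]
  note a = hom_obj(1)[OF f]
  note d = pair_props[OF ident_hom[OF a] ident_hom[OF a], folded diagonal_def]
  note h = biprod_arr_props[OF f g] and c = pair_props[OF f g]
  note p = proj1_hom[OF o] proj2_hom[OF o] proj1_hom[OF a a] proj2_hom[OF a a]
  show ?thesis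
    by (rule pair_ext[OF o comp_hom[OF d(1) h(1)] c(1)])
      (simp_all add: comp_assoc[OF d(1) h(1) p(1), symmetric]
        comp_assoc[OF d(1) h(1) p(2), symmetric] h c
        comp_assoc[OF d(1) p(3) f] comp_assoc[OF d(1) p(4) g] d
        comp_ident[OF f] comp_ident[OF g])
qed

lemma codiagonal_hom: "a \<in> obj C \<Longrightarrow> \<nabla> a \<in> Hom (a \<^bold>\<oplus>\<^sub>o a) a"
  unfolding codiagonal_def by (intro copair_props ident_hom)

lemma diagonal_hom: "a \<in> obj C \<Longrightarrow> \<Delta> a \<in> Hom a (a \<^bold>\<oplus>\<^sub>o a)"
  unfolding diagonal_def by (intro pair_props ident_hom)

text \<open>A sum can be read as the codiagonal after a pairing or as a copairing after the
  diagonal. The first form absorbs precomposition, the second postcomposition, so composition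
  distributes over addition on both sides.\<close>

lemma add_arr_pair:
  assumes f: "f \<in> Hom a b" and g: "g \<in> Hom a b"
  shows "add_arr C f g = \<nabla> b \<cdot> pair C f g"
  using biprod_arr_diagonal[OF f g] by (simp add: add_arr_def homD[OF f])

lemma add_arr_copair:
  assumes f: "f \<in> Hom a b" and g: "g \<in> Hom a b"
  shows "add_arr C f g = copair C f g \<cdot> \<Delta> a"
proof -
  note o = hom_obj[OF f]
  show ?thesis
    using comp_assoc[OF diagonal_hom[OF o(1)] biprod_arr_props(1)[OF f g] codiagonal_hom[OF o(2)]]
    by (simp add: add_arr_def homD[OF f] codiagonal_biprod_arr[OF f g])
qed

lemma add_arr_hom:
  assumes f: "f \<in> Hom a b" and g: "g \<in> Hom a b"
  shows "add_arr C f g \<in> Hom a b"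
  unfolding add_arr_copair[OF f g]
  by (rule comp_hom[OF diagonal_hom[OF hom_obj(1)[OF f]] copair_props(1)[OF f g]])

lemma comp_add_arr:
  assumes f: "f \<in> Hom a b" and g: "g \<in> Hom a b" and h: "h \<in> Hom b c"
  shows "h \<cdot> add_arr C f g = add_arr C (h \<cdot> f) (h \<cdot> g)"
  unfolding add_arr_copair[OF f g] add_arr_copair[OF comp_hom[OF f h] comp_hom[OF g h]]
    comp_copair[OF f g h, symmetric]
  by (rule comp_assoc[OF diagonal_hom[OF hom_obj(1)[OF f]] copair_props(1)[OF f g] h, symmetric])

lemma add_arr_comp:
  assumes f: "f \<in> Hom a b" and g: "g \<in> Hom a b" and h: "h \<in> Hom c a"
  shows "add_arr C f g \<cdot> h = add_arr C (f \<cdot> h) (g \<cdot> h)"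
  unfolding add_arr_pair[OF f g] add_arr_pair[OF comp_hom[OF h f] comp_hom[OF h g]]
    pair_comp[OF f g h, symmetric]
  by (rule comp_assoc[OF h pair_props(1)[OF f g] codiagonal_hom[OF hom_obj(2)[OF f]]])

section \<open>Commutants as subsemialgebras\<close>

lemma zero_commutant:
  assumes "X \<in> obj C" "R \<subseteq> Hom X X"
  shows "\<^bold>0 X X \<in> commutant C X R"
  using assms by (auto intro!: commutantI zero_arr_hom simp: comp_zero zero_comp subset_iff)

lemma add_commutant:
  assumes R: "R \<subseteq> Hom X X" and f: "f \<in> commutant C X R" and g: "g \<in> commutant C X R"
  shows "add_arr C f g \<in> commutant C X R"
proof (rule commutantI)
  note f' = commutantD[OF f] and g' = commutantD[OF g]
  show "add_arr C f g \<in> Hom X X" by (rule add_arr_hom[OF f'(1) g'(1)])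
  fix h assume h: "h \<in> R"
  then have hX: "h \<in> Hom X X" using R by blast
  show "add_arr C f g \<cdot> h = h \<cdot> add_arr C f g"
    by (simp add: add_arr_comp[OF f'(1) g'(1) hX] comp_add_arr[OF f'(1) g'(1) hX]
        f'(2)[OF h] g'(2)[OF h])
qed

text \<open>Stated for any set of endomorphisms closed under the dagger; that closure is what
  stability under the involution rests on.\<close>

lemma star_subsemialgebra_commutant:
  assumes X: "X \<in> obj C" and R: "R \<subseteq> Hom X X" and dag: "\<And>g. g \<in> R \<Longrightarrow> g\<^sup>\<dagger> \<in> R"
  shows "star_subsemialgebra (scalars C) (commutant C X R) (End_semialgebra C X)"
  unfolding star_subsemialgebra_def End_semialgebra_def scalars_def
  using zero_commutant[OF X R] ident_commutant[OF X R] add_commutant[OF R] comp_commutant[OF R]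
    smult_commutant[OF R] dag_commutant[OF R dag] commutantD(1)
  by auto

end

section \<open>H*-algebras\<close>

context dagger_symmetric_monoidal_category
begin

lemma R_op_hom:
  assumes \<mu>: "\<mu> \<in> Hom (X \<^bold>\<otimes>\<^sub>o X) X" and x: "x \<in> Hom \<^bold>I X"
  shows "R_op C X \<mu> x \<in> Hom X X"
proof -
  note X = hom_obj(2)[OF x]
  show ?thesis
    unfolding R_op_def lunit_dag(1)[OF X X]
    by (rule comp_hom[OF comp_hom[OF lunit_dag(2)[OF X X] tens_hom[OF x ident_hom[OF X]]] \<mu>])
qed

text \<open>Naturality of the inverse unitor turns the operator applied to a point into a product of
  two points, a form in which both play the same role.\<close>

lemma R_op_comp:
  assumes \<mu>: "\<mu> \<in> Hom (X \<^bold>\<otimes>\<^sub>o X) X" and x: "x \<in> Hom \<^bold>I X" and y: "y \<in> Hom \<^bold>I X"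
  shows "R_op C X \<mu> x \<cdot> y = \<mu> \<cdot> (x \<^bold>\<otimes> y) \<cdot> (lunit C \<^bold>I)\<^sup>\<dagger>"
proof -
  note X = hom_obj(2)[OF x] and I = ident_hom[OF unit_obj]
  note l = lunit_dag(2)[OF X X] and l' = lunit_dag(2)[OF unit_obj unit_obj]
  note xX = tens_hom[OF x ident_hom[OF X]] and Iy = tens_hom[OF I y]
  have "R_op C X \<mu> x \<cdot> y = \<mu> \<cdot> (x \<^bold>\<otimes> \<^bold>1 X) \<cdot> ((lunit C X)\<^sup>\<dagger> \<cdot> y)"
    unfolding R_op_def lunit_dag(1)[OF X X]
    using \<mu> xX l y by (simp add: hom_def arr_comp)
  also have "\<dots> = \<mu> \<cdot> ((x \<^bold>\<otimes> \<^bold>1 X) \<cdot> (\<^bold>1 \<^bold>I \<^bold>\<otimes> y)) \<cdot> (lunit C \<^bold>I)\<^sup>\<dagger>"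
    unfolding lunit_dag_natural[OF y]
    using \<mu> xX Iy l' by (simp add: hom_def arr_comp)
  also have "(x \<^bold>\<otimes> \<^bold>1 X) \<cdot> (\<^bold>1 \<^bold>I \<^bold>\<otimes> y) = x \<^bold>\<otimes> y"
    by (simp add: tens_comp[OF I x y ident_hom[OF X], symmetric] comp_ident[OF x] ident_comp[OF y])
  finally show ?thesis .
qed

text \<open>Commutativity of \<open>\<mu>\<close> read on points: naturality of the braiding swaps
  the factors and leaves the self-braiding of the unit object, which is an identity.\<close>

lemma R_op_commute:
  assumes \<mu>: "\<mu> \<in> Hom (X \<^bold>\<otimes>\<^sub>o X) X" and comm: "\<mu> \<cdot> braid C X X = \<mu>"
    and x: "x \<in> Hom \<^bold>I X" and y: "y \<in> Hom \<^bold>I X"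
  shows "R_op C X \<mu> x \<cdot> y = R_op C X \<mu> y \<cdot> x"
proof -
  note X = hom_obj(2)[OF x]
  note l = lunit_hom[OF unit_obj] lunit_dag(2)[OF unit_obj unit_obj]
  note b = braid_hom[OF X X] and bI = braid_hom[OF unit_obj unit_obj]
  note xy = tens_hom[OF x y] and yx = tens_hom[OF y x]
  \<comment> \<open>The unitor can be cancelled: at the unit object \<open>braid_unit\<close> says
    that \<open>lunit\<close> after the braiding is \<open>runit\<close>, and the two unitors agree
    there.\<close>
  have "braid C \<^bold>I \<^bold>I = ((lunit C \<^bold>I)\<^sup>\<dagger> \<cdot> lunit C \<^bold>I) \<cdot> braid C \<^bold>I \<^bold>I"
    by (simp add: lunit_dag(3) unit_obj ident_comp[OF bI])
  also have "\<dots> = (lunit C \<^bold>I)\<^sup>\<dagger> \<cdot> lunit C \<^bold>I"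
    by (simp add: comp_assoc[OF bI l] braid_unit[OF unit_obj] lunit_unit[symmetric])
  finally have braid_I: "braid C \<^bold>I \<^bold>I = \<^bold>1 (\<^bold>I \<^bold>\<otimes>\<^sub>o \<^bold>I)"
    by (simp add: lunit_dag(3) unit_obj)
  have "\<mu> \<cdot> (x \<^bold>\<otimes> y) = \<mu> \<cdot> (braid C X X \<cdot> (x \<^bold>\<otimes> y))"
    using comp_assoc[OF xy b \<mu>] comm by simp
  also have "\<dots> = \<mu> \<cdot> (y \<^bold>\<otimes> x)"
    by (simp add: braid_natural[OF x y] braid_I comp_ident[OF yx])
  finally have "\<mu> \<cdot> (x \<^bold>\<otimes> y) = \<mu> \<cdot> (y \<^bold>\<otimes> x)" .
  then show ?thesis
    unfolding R_op_comp[OF \<mu> x y] R_op_comp[OF \<mu> y x]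
    using comp_assoc[OF l(2) xy \<mu>] comp_assoc[OF l(2) yx \<mu>] by simp
qed

text \<open>The adjoint of condition (H) is multiplication on the right by the adjoint of
  \<open>y\<close>; commutativity of \<open>\<mu>\<close> moves it to the left, at the price of
  exchanging the unitors.\<close>

lemma dag_R_op:
  assumes \<mu>: "\<mu> \<in> Hom (X \<^bold>\<otimes>\<^sub>o X) X" and comm: "\<mu> \<cdot> braid C X X = \<mu>"
    and x: "x \<in> Hom \<^bold>I X" and H: "H_copoint C X \<mu> x y"
  shows "(R_op C X \<mu> x)\<^sup>\<dagger> = R_op C X \<mu> (y\<^sup>\<dagger>)"
proof -
  note X = hom_obj(2)[OF x] and I = unit_obj
  have y: "y \<in> Hom X \<^bold>I" and R: "R_op C X \<mu> x = runit C X \<cdot> (\<^bold>1 X \<^bold>\<otimes> y) \<cdot> \<mu>\<^sup>\<dagger>"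
    using H by (simp_all add: H_copoint_def)
  note y' = dag_hom[OF y] and \<mu>' = dag_hom[OF \<mu>] and X1 = ident_hom[OF X]
  note r = runit_hom[OF X] runit_dag(2)[OF X X] and l = lunit_hom[OF X] lunit_dag(2)[OF X X]
  note b = braid_hom[OF X I] braid_dag(2)[OF X I X I] and bX = braid_hom[OF X X]
  note Xy = tens_hom[OF X1 y] and Xy' = tens_hom[OF X1 y'] and yX' = tens_hom[OF y' X1]
  \<comment> \<open>Cancelling the unitary braiding in \<open>braid_unit\<close> and then taking
    adjoints expresses the inverse left unitor through the inverse right one.\<close>
  have "lunit C X = lunit C X \<cdot> (braid C X \<^bold>I \<cdot> (braid C X \<^bold>I)\<^sup>\<dagger>)"
    by (simp add: braid_dag(4)[OF X I X I] comp_ident[OF l(1)])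
  also have "\<dots> = runit C X \<cdot> (braid C X \<^bold>I)\<^sup>\<dagger>"
    using comp_assoc[OF b(2,1) l(1)] by (simp add: braid_unit[OF X])
  finally have unit: "(lunit C X)\<^sup>\<dagger> = braid C X \<^bold>I \<cdot> (runit C X)\<^sup>\<dagger>"
    using dag_comp[OF b(2) r(1)] dag_dag[OF b(1)] by simp
  have "(R_op C X \<mu> x)\<^sup>\<dagger> = (\<mu> \<cdot> (\<^bold>1 X \<^bold>\<otimes> y\<^sup>\<dagger>)) \<cdot> (runit C X)\<^sup>\<dagger>"
    unfolding R dag_comp[OF comp_hom[OF \<mu>' Xy] r(1)] dag_comp[OF \<mu>' Xy]
    by (simp add: dag_dag[OF \<mu>] dag_tens[OF X1 y] dag_ident X)
  also have "\<mu> \<cdot> (\<^bold>1 X \<^bold>\<otimes> y\<^sup>\<dagger>) = \<mu> \<cdot> (braid C X X \<cdot> (\<^bold>1 X \<^bold>\<otimes> y\<^sup>\<dagger>))"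
    using comp_assoc[OF Xy' bX \<mu>] comm by simp
  also have "\<dots> = \<mu> \<cdot> (y\<^sup>\<dagger> \<^bold>\<otimes> \<^bold>1 X) \<cdot> braid C X \<^bold>I"
    by (simp add: braid_natural[OF X1 y'])
  also have "(\<mu> \<cdot> (y\<^sup>\<dagger> \<^bold>\<otimes> \<^bold>1 X) \<cdot> braid C X \<^bold>I) \<cdot> (runit C X)\<^sup>\<dagger> =
    \<mu> \<cdot> (y\<^sup>\<dagger> \<^bold>\<otimes> \<^bold>1 X) \<cdot> (braid C X \<^bold>I \<cdot> (runit C X)\<^sup>\<dagger>)"
    using \<mu> yX' b(1) r(2) by (simp add: hom_def arr_comp)
  also have "\<dots> = R_op C X \<mu> (y\<^sup>\<dagger>)"
    by (simp add: R_op_def lunit_dag(1)[OF X X] unit)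
  finally show ?thesis .
qed

lemma R_set_hom:
  assumes "\<mu> \<in> Hom (X \<^bold>\<otimes>\<^sub>o X) X"
  shows "R_set C X \<mu> \<subseteq> Hom X X"
  using R_op_hom[OF assms] by (auto simp: R_set_def)

text \<open>Condition (H) supplies a copoint for the point defining \<open>g\<close>; the adjoint of
  this copoint is the point that defines the adjoint operator.\<close>

lemma dag_R_set:
  assumes H: "H_star_algebra C X \<mu>" and g: "g \<in> R_set C X \<mu>"
  shows "g\<^sup>\<dagger> \<in> R_set C X \<mu>"
proof -
  obtain x where x: "x \<in> Hom \<^bold>I X" and gx: "g = R_op C X \<mu> x"
    using g by (auto simp: R_set_def)
  obtain y where y: "H_copoint C X \<mu> x y"
    using H x by (auto simp: H_star_algebra_def)
  have "g\<^sup>\<dagger> = R_op C X \<mu> (y\<^sup>\<dagger>)"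
    using H x y by (simp add: gx dag_R_op H_star_algebra_def)
  moreover have "y\<^sup>\<dagger> \<in> Hom \<^bold>I X"
    using y dag_hom by (simp add: H_copoint_def)
  ultimately show ?thesis
    by (auto simp: R_set_def)
qed

text \<open>Write \<open>\<alpha>\<close> as its own square. Elements of the commutant move onto the
  second factor of a product, so \<open>g\<close> goes there first; a swap by
  \<open>R_op_commute\<close> brings the other copy of \<open>\<alpha>\<close> into second place for
  \<open>f\<close>, and a last swap restores the order.\<close>

lemma commutant_comp_idempotent:
  assumes \<mu>: "\<mu> \<in> Hom (X \<^bold>\<otimes>\<^sub>o X) X" and comm: "\<mu> \<cdot> braid C X X = \<mu>"
    and \<alpha>: "\<alpha> \<in> Hom \<^bold>I X" and idem: "R_op C X \<mu> \<alpha> \<cdot> \<alpha> = \<alpha>"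
    and f: "f \<in> commutant C X (R_set C X \<mu>)" and g: "g \<in> commutant C X (R_set C X \<mu>)"
  shows "(f \<cdot> g) \<cdot> \<alpha> = R_op C X \<mu> (f \<cdot> \<alpha>) \<cdot> (g \<cdot> \<alpha>)"
proof -
  note fX = commutantD(1)[OF f] and gX = commutantD(1)[OF g]
  note fa = comp_hom[OF \<alpha> fX] and ga = comp_hom[OF \<alpha> gX]
  have move: "h \<cdot> (R_op C X \<mu> x \<cdot> y) = R_op C X \<mu> x \<cdot> (h \<cdot> y)"
    if h: "h \<in> commutant C X (R_set C X \<mu>)" and x: "x \<in> Hom \<^bold>I X" and y: "y \<in> Hom \<^bold>I X" for h x y
  proof -
    have "R_op C X \<mu> x \<in> R_set C X \<mu>" using x by (auto simp: R_set_def)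
    then show ?thesis
      using commutantD(2)[OF h] comp_assoc[OF y R_op_hom[OF \<mu> x] commutantD(1)[OF h]]
        comp_assoc[OF y commutantD(1)[OF h] R_op_hom[OF \<mu> x]] by metis
  qed
  have "(f \<cdot> g) \<cdot> \<alpha> = f \<cdot> (g \<cdot> (R_op C X \<mu> \<alpha> \<cdot> \<alpha>))"
    using comp_assoc[OF \<alpha> gX fX] idem by simp
  also have "\<dots> = f \<cdot> (R_op C X \<mu> (g \<cdot> \<alpha>) \<cdot> \<alpha>)"
    by (simp add: move[OF g \<alpha> \<alpha>] R_op_commute[OF \<mu> comm \<alpha> ga])
  also have "\<dots> = R_op C X \<mu> (f \<cdot> \<alpha>) \<cdot> (g \<cdot> \<alpha>)"
    by (simp add: move[OF f ga \<alpha>] R_op_commute[OF \<mu> comm ga fa])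
  finally show ?thesis .
qed

lemma set_like_mult:
  assumes H: "H_star_algebra C X \<mu>" and set: "\<alpha> \<in> set_likes C X \<mu>"
    and f: "f \<in> commutant C X (R_set C X \<mu>)" and g: "g \<in> commutant C X (R_set C X \<mu>)"
  shows "\<alpha>\<^sup>\<dagger> \<cdot> (f \<cdot> g) \<cdot> \<alpha> = (\<alpha>\<^sup>\<dagger> \<cdot> f \<cdot> \<alpha>) \<cdot> (\<alpha>\<^sup>\<dagger> \<cdot> g \<cdot> \<alpha>)"
proof -
  have \<mu>: "\<mu> \<in> Hom (X \<^bold>\<otimes>\<^sub>o X) X" and comm: "\<mu> \<cdot> braid C X X = \<mu>" and spec: "\<mu> \<cdot> \<mu>\<^sup>\<dagger> = \<^bold>1 X"
    using H by (simp_all add: H_star_algebra_def)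
  note I = unit_obj
  note l = lunit_hom[OF I] lunit_dag(2)[OF I I]
  have \<alpha>: "\<alpha> \<in> Hom \<^bold>I X" and copy: "\<mu>\<^sup>\<dagger> \<cdot> \<alpha> = (\<alpha> \<^bold>\<otimes> \<alpha>) \<cdot> (lunit C \<^bold>I)\<^sup>\<dagger>"
    using set by (simp_all add: set_likes_def lunit_dag(1)[OF I I])
  note \<alpha>' = dag_hom[OF \<alpha>] and \<mu>' = dag_hom[OF \<mu>]
  note aa = tens_hom[OF \<alpha> \<alpha>] and aa' = tens_hom[OF \<alpha>' \<alpha>']
  note fa = comp_hom[OF \<alpha> commutantD(1)[OF f]] and ga = comp_hom[OF \<alpha> commutantD(1)[OF g]]
  note fg = tens_hom[OF fa ga]
  \<comment> \<open>The copying equation makes the square of \<open>\<alpha>\<close> equal to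
    \<open>\<mu>\<close> after its adjoint after \<open>\<alpha>\<close>, which speciality
    collapses.\<close>
  have idem: "R_op C X \<mu> \<alpha> \<cdot> \<alpha> = \<alpha>"
    using R_op_comp[OF \<mu> \<alpha> \<alpha>] copy comp_assoc[OF \<alpha> \<mu>' \<mu>] spec ident_comp[OF \<alpha>] by simp
  \<comment> \<open>The adjoint of the copying equation makes the adjoint of \<open>\<alpha>\<close>
    a character: it sends products of points to tensor products of scalars, up to the
    unitor.\<close>
  have "(\<mu>\<^sup>\<dagger> \<cdot> \<alpha>)\<^sup>\<dagger> = ((\<alpha> \<^bold>\<otimes> \<alpha>) \<cdot> (lunit C \<^bold>I)\<^sup>\<dagger>)\<^sup>\<dagger>"
    using copy by simp
  then have copy': "\<alpha>\<^sup>\<dagger> \<cdot> \<mu> = lunit C \<^bold>I \<cdot> (\<alpha>\<^sup>\<dagger> \<^bold>\<otimes> \<alpha>\<^sup>\<dagger>)"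
    by (simp add: dag_comp[OF \<alpha> \<mu>'] dag_comp[OF l(2) aa] dag_dag[OF \<mu>] dag_dag[OF l(1)]
        dag_tens[OF \<alpha> \<alpha>])
  have "\<alpha>\<^sup>\<dagger> \<cdot> (f \<cdot> g) \<cdot> \<alpha> = \<alpha>\<^sup>\<dagger> \<cdot> \<mu> \<cdot> ((f \<cdot> \<alpha>) \<^bold>\<otimes> (g \<cdot> \<alpha>)) \<cdot> (lunit C \<^bold>I)\<^sup>\<dagger>"
    using commutant_comp_idempotent[OF \<mu> comm \<alpha> idem f g] R_op_comp[OF \<mu> fa ga] by simp
  also have "\<dots> = (\<alpha>\<^sup>\<dagger> \<cdot> \<mu>) \<cdot> ((f \<cdot> \<alpha>) \<^bold>\<otimes> (g \<cdot> \<alpha>)) \<cdot> (lunit C \<^bold>I)\<^sup>\<dagger>"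
    by (rule comp_assoc[OF comp_hom[OF l(2) fg] \<mu> \<alpha>', symmetric])
  also have "\<dots> = lunit C \<^bold>I \<cdot> ((\<alpha>\<^sup>\<dagger> \<^bold>\<otimes> \<alpha>\<^sup>\<dagger>) \<cdot> ((f \<cdot> \<alpha>) \<^bold>\<otimes> (g \<cdot> \<alpha>))) \<cdot> (lunit C \<^bold>I)\<^sup>\<dagger>"
    unfolding copy' using l aa' fg by (simp add: hom_def arr_comp)
  \<comment> \<open>By the interchange law the middle is a tensor product of two scalars; conjugated
    by the unitor it is their composite.\<close>
  also have "\<dots> = (\<alpha>\<^sup>\<dagger> \<cdot> f \<cdot> \<alpha>) \<cdot> (\<alpha>\<^sup>\<dagger> \<cdot> g \<cdot> \<alpha>)"
    unfolding tens_comp[OF fa \<alpha>' ga \<alpha>', symmetric]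
    by (rule lunit_tens_scalars[OF comp_hom[OF fa \<alpha>'] comp_hom[OF ga \<alpha>']])
  finally show ?thesis .
qed

end

text \<open>\<open>star_semialgebra_hom\<close> tests operations only, so the first conjunct records
  that the commutant is a genuine subsemialgebra and can serve as the domain. The two choices of
  \<open>A\<close> are the conventions of admitting or excluding the zero point as set-like; under
  orthonormality a zero point in \<open>A\<close> forces the identity scalar to be zero.\<close>

theorem theorem19:
  fixes C :: "('o, 'm, 'z) dagger_smc_biprod_scheme" (structure)
  assumes "dagger_smc_biproducts C"
    and "H_star_algebra C X \<mu>"
    and "A = set_likes C X \<mu> \<or> A = set_likes C X \<mu> - {\<^bold>0 \<^bold>I X}"
    and "orthonormal C A"
    and "\<alpha> \<in> A"
  shows "star_subsemialgebra (scalars C) (commutant C X (R_set C X \<mu>)) (End_semialgebra C X) \<and>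
    (\<lambda>f. \<alpha>\<^sup>\<dagger> \<cdot> f \<cdot> \<alpha>) \<in> star_semialgebra_hom (scalars C)
      (von_Neumann_semialgebra C X \<mu>) (End_semialgebra C \<^bold>I)"
proof -
  interpret dagger_smc_biproducts C by (rule assms(1))
  let ?R = "R_set C X \<mu>" and ?\<rho> = "\<lambda>f. \<alpha>\<^sup>\<dagger> \<cdot> f \<cdot> \<alpha>"
  have X: "X \<in> obj C" and \<mu>: "\<mu> \<in> Hom (X \<^bold>\<otimes>\<^sub>o X) X"
    using assms(2) by (simp_all add: H_star_algebra_def)
  have set: "\<alpha> \<in> set_likes C X \<mu>"
    using assms(3,5) by blast
  then have \<alpha>: "\<alpha> \<in> Hom \<^bold>I X"
    by (simp add: set_likes_def)
  note \<alpha>' = dag_hom[OF \<alpha>]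
  \<comment> \<open>Orthonormality enters here, with both set-like elements equal to
    \<open>\<alpha>\<close>.\<close>
  have unit: "?\<rho> (\<^bold>1 X) = \<^bold>1 \<^bold>I"
    using assms(4,5) by (simp add: orthonormal_def ident_comp[OF \<alpha>])
  have zero: "?\<rho> (\<^bold>0 X X) = \<^bold>0 \<^bold>I \<^bold>I"
    by (simp add: zero_comp[OF X \<alpha>] comp_zero[OF unit_obj \<alpha>'])
  have hom: "?\<rho> f \<in> Hom \<^bold>I \<^bold>I" if "f \<in> Hom X X" for f
    by (rule comp_hom[OF comp_hom[OF \<alpha> that] \<alpha>'])
  have add: "?\<rho> (add_arr C f g) = add_arr C (?\<rho> f) (?\<rho> g)"
    if f: "f \<in> Hom X X" and g: "g \<in> Hom X X" for f g
    by (simp add: add_arr_comp[OF f g \<alpha>] comp_add_arr[OF comp_hom[OF \<alpha> f] comp_hom[OF \<alpha> g] \<alpha>'])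
  have dag: "?\<rho> (f\<^sup>\<dagger>) = (?\<rho> f)\<^sup>\<dagger>" if f: "f \<in> Hom X X" for f
    by (simp add: dag_comp[OF comp_hom[OF \<alpha> f] \<alpha>'] dag_comp[OF \<alpha> f] dag_dag[OF \<alpha>]
        comp_assoc[OF \<alpha> dag_hom[OF f] \<alpha>'])
  \<comment> \<open>Homogeneity is \<open>comp_smult_comp\<close> with \<open>\<alpha>\<close> on
    the right and its adjoint on the left. Additivity, homogeneity and compatibility with the dagger
    hold on all of \<open>Hom X X\<close>; multiplicativity is where membership in the commutant is
    used.\<close>
  have "?\<rho> \<in> star_semialgebra_hom (scalars C) (von_Neumann_semialgebra C X \<mu>) (End_semialgebra C \<^bold>I)"
    using unit zero hom add dag set_like_mult[OF assms(2) set] comp_smult_comp[OF _ _ \<alpha>' \<alpha>]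
    by (auto simp: star_semialgebra_hom_def ring_hom_def von_Neumann_semialgebra_def
        End_semialgebra_def scalars_def dest!: commutantD(1))
  moreover have "star_subsemialgebra (scalars C) (commutant C X ?R) (End_semialgebra C X)"
    by (rule star_subsemialgebra_commutant[OF X R_set_hom[OF \<mu>] dag_R_set[OF assms(2)]])
  ultimately show ?thesis by blast
qed

end
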